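(* There exist a field $\mathcal{F}\subset\mathbb{R}$ and polytopes $P,Q\subset\mathbb{R}^{4}$ such that: (I) the vertices of both $P$ and $Q$ have coordinates in $\mathcal{F}$; (II) $\dim P=4$ and $P\subset Q$; (III) there is a $4$-simplex $\Delta$ satisfying $P\subset\Delta\subset Q$; (IV) every $4$-simplex $\Delta$ satisfying $P\subset\Delta\subset Q$ has a vertex not all of whose coordinates belong to $\mathcal{F}$.
   Context: A polytope is the convex hull of a finite set of points. A $4$-simplex is the convex hull of five affinely independent points (its vertices). $\mathcal{F}$ is a subfield of $\mathbb{R}$. *)

theory Defs
  imports "HOL-Analysis.Analysis" "HOL-Algebra.Algebraic_Closure_Type"
begin

definition has_coords_in :: "real ^ 'n \<Rightarrow> real set \<Rightarrow> bool" where
  "has_coords_in x F \<longleftrightarrow> (\<forall>i. x $ i \<in> F)"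

end

theory Submission
  imports Defs
begin

text \<open>
  Everything happens, up to scaling, in the cone over a tetrahedron: \<open>Q\<close> has apex \<open>0\<close>, lies in the
  nonnegative orthant, and is pinched so that it meets neither \<open>y\<^sub>1 = y\<^sub>3 = 0\<close> nor \<open>y\<^sub>2 = y\<^sub>4 = 0\<close>
  outside the apex. The apex belongs to \<open>P\<close>, hence is a vertex of \<open>\<Delta>\<close>; let \<open>V\<close> be the set of the
  other four vertices. For each \<open>i\<close>, \<open>P\<close> has a vertex whose only zero coordinate is the \<open>i\<close>-th, and
  it must be a nonnegative combination of \<open>Z\<^sub>i = {v \<in> V. v\<^sub>i = 0}\<close>. So the \<open>Z\<^sub>i\<close> form an antichain with
  \<open>Z\<^sub>1 \<inter> Z\<^sub>3 = Z\<^sub>2 \<inter> Z\<^sub>4 = {}\<close>, which for four points leaves two possibilities. Either the \<open>Z\<^sub>i\<close> are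
  disjoint singletons and \<open>\<Delta>\<close> is spanned by multiples of these four vertices of \<open>P\<close>, excluded by the
  further vertex \<open>(1, 3, 1, 3)\<close> of \<open>P\<close>; or the four points of \<open>V\<close> lie cyclically on the two-dimensional
  faces \<open>y\<^sub>i = y\<^sub>i\<^sub>+\<^sub>1 = 0\<close> of the orthant. In the latter case their slopes \<open>r\<close> are linked cyclically by
  \<open>r \<mapsto> 1 / (4 - r)\<close>, which forces \<open>r\<^sup>2 - 4 r + 1 = 0\<close>, that is \<open>r = 2 \<plusminus> \<surd>3\<close>.
\<close>

no_notation fps_nth (infixl \<open>$\<close> 75)

definition vec4 :: "real \<Rightarrow> real \<Rightarrow> real \<Rightarrow> real \<Rightarrow> real ^ 4" where
  "vec4 a b c d = (\<chi> i. if i = 1 then a else if i = 2 then b else if i = 3 then c else d)"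

lemma vec4_nth [simp]:
  "vec4 a b c d $ 1 = a" "vec4 a b c d $ 2 = b" "vec4 a b c d $ 3 = c" "vec4 a b c d $ 4 = d"
  by (simp_all add: vec4_def)

lemma vec4_eq_iff: "x = y \<longleftrightarrow> x $ 1 = y $ 1 \<and> x $ 2 = y $ 2 \<and> x $ 3 = y $ 3 \<and> x $ 4 = y $ 4"
  for x y :: "real ^ 4"
  by (simp add: vec_eq_iff forall_4)

lemma vec4_cases:
  obtains a b c d where "y = vec4 a b c d"
proof
  show "y = vec4 (y $ 1) (y $ 2) (y $ 3) (y $ 4)" by (simp add: vec4_eq_iff)
qed

section \<open>Antichains of four subsets of a four-element set\<close>

lemma card_2_eq_doubleton:
  assumes "card S = 2" "x \<in> S" "y \<in> S" "x \<noteq> y"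
  shows "S = {x, y}"
  using assms by (auto simp: card_2_iff)

text \<open>Incomparability keeps \<open>a\<close> and \<open>b\<close> distinct and outside
  \<open>C\<close> and \<open>D\<close>, so \<open>C\<close> and \<open>D\<close> are incomparable
  subsets of the two remaining points.\<close>

lemma antichain_four_singletons:
  assumes "card V = 4" "A \<union> B \<union> C \<union> D \<subseteq> V" "A = {a}" "B = {b}"
    and "\<not> A \<subseteq> B" "\<not> A \<subseteq> C" "\<not> A \<subseteq> D" "\<not> B \<subseteq> C" "\<not> B \<subseteq> D" "\<not> C \<subseteq> D" "\<not> D \<subseteq> C"
  shows "\<exists>c d. C = {c} \<and> D = {d} \<and> V = {a, b, c, d}"
proof -
  have ab: "a \<in> V" "b \<in> V" "a \<noteq> b" "C \<subseteq> V - {a, b}" "D \<subseteq> V - {a, b}"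
    using assms by auto
  have "card (V - {a, b}) = 2"
    using ab assms(1) by (subst card_Diff_subset) auto
  moreover obtain c d where cd: "c \<in> C" "c \<notin> D" "d \<in> D" "d \<notin> C"
    using assms(10,11) by blast
  ultimately have eq: "V - {a, b} = {c, d}"
    using ab by (intro card_2_eq_doubleton) auto
  then have "C \<subseteq> {c, d}" "D \<subseteq> {c, d}" using ab by simp_all
  then have "C = {c}" "D = {d}" using cd by auto
  moreover have "V = {a, b, c, d}" using ab eq by auto
  ultimately show ?thesis by blast
qed

text \<open>The disjoint sets \<open>B\<close> and \<open>D\<close> avoid \<open>a\<close>, so they
  share three points and one of them is a singleton. This gives the second singleton.\<close>

lemma antichain_four_singleton:
  assumes V: "card V = 4" "A \<union> B \<union> C \<union> D \<subseteq> V"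
    and a: "A = {a}" and dis: "B \<inter> D = {}"
    and n: "\<not> A \<subseteq> B" "\<not> A \<subseteq> C" "\<not> A \<subseteq> D" "\<not> B \<subseteq> A" "\<not> B \<subseteq> C" "\<not> B \<subseteq> D"
      "\<not> C \<subseteq> A" "\<not> C \<subseteq> B" "\<not> C \<subseteq> D" "\<not> D \<subseteq> A" "\<not> D \<subseteq> B" "\<not> D \<subseteq> C"
  shows "\<exists>b c d. B = {b} \<and> C = {c} \<and> D = {d} \<and> V = {a, b, c, d}"
proof -
  have fin: "finite V" using V(1) by (metis card.infinite zero_neq_numeral)
  then have finBD: "finite B" "finite D" using V(2) by (auto intro: finite_subset)
  have "card (B \<union> D) \<le> card (V - {a})"
    using fin V a n by (intro card_mono) auto
  then have "card B + card D \<le> 3"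
    using fin V a finBD dis by (simp add: card_Un_disjoint)
  moreover have "card B \<noteq> 0" "card D \<noteq> 0" using finBD n by auto
  ultimately have "card B = 1 \<or> card D = 1" by linarith
  then show ?thesis
  proof
    assume "card B = 1"
    then obtain b where b: "B = {b}" by (auto simp: card_1_singleton_iff)
    show ?thesis
      using antichain_four_singletons[OF V a b n(1-3,5,6,9,12)] b by blast
  next
    assume "card D = 1"
    then obtain d where d: "D = {d}" by (auto simp: card_1_singleton_iff)
    have "A \<union> D \<union> C \<union> B \<subseteq> V" using V by auto
    from antichain_four_singletons[OF V(1) this a d n(3,2,1,12,11,8,5)]
    show ?thesis using d by (auto simp: insert_commute)
  qed
qed

text \<open>The hypotheses are invariant under rotating \<open>A\<close>, \<open>B\<close>,
  \<open>C\<close>, \<open>D\<close>, so any singleton may be taken to be the first set. Without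
  singletons, disjointness of opposite sets forces all cardinalities to be 2.\<close>

lemma antichain_four_cases:
  assumes V: "card V = 4" "A \<union> B \<union> C \<union> D \<subseteq> V"
    and dis: "A \<inter> C = {}" "B \<inter> D = {}"
    and n: "\<not> A \<subseteq> B" "\<not> A \<subseteq> C" "\<not> A \<subseteq> D" "\<not> B \<subseteq> A" "\<not> B \<subseteq> C" "\<not> B \<subseteq> D"
      "\<not> C \<subseteq> A" "\<not> C \<subseteq> B" "\<not> C \<subseteq> D" "\<not> D \<subseteq> A" "\<not> D \<subseteq> B" "\<not> D \<subseteq> C"
  obtains (disjoint) a b c d where "A = {a}" "B = {b}" "C = {c}" "D = {d}" "V = {a, b, c, d}"
  | (cycle) w x y z where "A = {w, x}" "B = {x, y}" "C = {y, z}" "D = {z, w}"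
proof (cases "card A = 1 \<or> card B = 1 \<or> card C = 1 \<or> card D = 1")
  case True
  have dis': "C \<inter> A = {}" "D \<inter> B = {}" using dis by auto
  have V': "B \<union> C \<union> D \<union> A \<subseteq> V" "C \<union> D \<union> A \<union> B \<subseteq> V" "D \<union> A \<union> B \<union> C \<subseteq> V"
    using V by auto
  have "\<exists>a b c d. A = {a} \<and> B = {b} \<and> C = {c} \<and> D = {d} \<and> V = {a, b, c, d}"
    using True
  proof (elim disjE)
    assume "card A = 1"
    then obtain a where "A = {a}" by (auto simp: card_1_singleton_iff)
    from antichain_four_singleton[OF V this dis(2) n] this show ?thesis by blast
  next
    assume "card B = 1"
    then obtain b where "B = {b}" by (auto simp: card_1_singleton_iff)
    from antichain_four_singleton[OF V(1) V'(1) this dis'(1) n(5,6,4,8,9,7,11,12,10,1,2,3)] this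
    show ?thesis by (auto simp: insert_commute)
  next
    assume "card C = 1"
    then obtain c where "C = {c}" by (auto simp: card_1_singleton_iff)
    from antichain_four_singleton[OF V(1) V'(2) this dis'(2) n(9,7,8,12,10,11,2,3,1,5,6,4)] this
    show ?thesis by (auto simp: insert_commute)
  next
    assume "card D = 1"
    then obtain d where "D = {d}" by (auto simp: card_1_singleton_iff)
    from antichain_four_singleton[OF V(1) V'(3) this dis(1) n(10,11,12,3,1,2,6,4,5,9,7,8)] this
    show ?thesis by (auto simp: insert_commute)
  qed
  then show thesis using disjoint by blast
next
  case False
  have fin: "finite V" using V(1) by (metis card.infinite zero_neq_numeral)
  then have fs: "finite A" "finite B" "finite C" "finite D" using V(2) by (auto intro: finite_subset)
  have "card A \<noteq> 0" "card B \<noteq> 0" "card C \<noteq> 0" "card D \<noteq> 0" using fs n by auto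
  with False have ge: "card A \<ge> 2" "card B \<ge> 2" "card C \<ge> 2" "card D \<ge> 2" by linarith+
  have "card (A \<union> C) \<le> 4" "card (B \<union> D) \<le> 4"
    using V fin card_mono[of V "A \<union> C"] card_mono[of V "B \<union> D"] by auto
  with fs dis have le: "card A + card C \<le> 4" "card B + card D \<le> 4"
    by (simp_all add: card_Un_disjoint)
  with ge have c2: "card A = 2" "card B = 2" "card C = 2" "card D = 2" by linarith+
  have un: "A \<union> C = V" "B \<union> D = V"
    using V fin fs c2 dis by (intro card_subset_eq; simp add: card_Un_disjoint)+
  \<comment> \<open>Opposite sets are now complementary in \<open>V\<close>: an element of
    \<open>A\<close> outside \<open>D\<close> lies in \<open>B\<close>, and likewise around the
    cycle.\<close>
  obtain x y where x: "x \<in> A" "x \<in> B" and y: "y \<in> B" "y \<in> C" using n(3,4) un V(2) by blast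
  obtain z w where z: "z \<in> C" "z \<in> D" and w: "w \<in> D" "w \<in> A" using n(8,12) un V(2) by blast
  have "w \<noteq> x" "x \<noteq> y" "y \<noteq> z" "z \<noteq> w" using x y z w dis by auto
  with c2 x y z w have "A = {w, x}" "B = {x, y}" "C = {y, z}" "D = {z, w}"
    by (intro card_2_eq_doubleton; simp)+
  then show thesis by (rule cycle)
qed

section \<open>Cones spanned by finite sets\<close>

definition nonneg_comb :: "'a :: real_vector set \<Rightarrow> 'a \<Rightarrow> bool" where
  "nonneg_comb V p \<longleftrightarrow> (\<exists>u. (\<forall>v\<in>V. 0 \<le> u v) \<and> p = (\<Sum>v\<in>V. u v *\<^sub>R v))"

lemma convex_hull_imp_nonneg_comb:
  assumes "finite C" "p \<in> convex hull C"
  shows "nonneg_comb (C - {0}) p"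
proof -
  obtain u where "\<forall>v\<in>C. 0 \<le> u v" "p = (\<Sum>v\<in>C. u v *\<^sub>R v)"
    using assms by (auto simp: convex_hull_finite)
  moreover have "(\<Sum>v\<in>C. u v *\<^sub>R v) = (\<Sum>v\<in>C - {0}. u v *\<^sub>R v)"
    using assms(1) by (intro sum.mono_neutral_right) auto
  ultimately show ?thesis unfolding nonneg_comb_def by auto
qed

text \<open>A sum of nonnegative terms vanishes only termwise, so a generator with
  \<open>v $ i > 0\<close> has weight 0.\<close>

lemma nonneg_comb_face:
  fixes p :: "real ^ 'n"
  assumes "finite V" "nonneg_comb V p" "p $ i = 0" "\<And>v. v \<in> V \<Longrightarrow> 0 \<le> v $ i"
  shows "nonneg_comb {v \<in> V. v $ i = 0} p"
proof -
  obtain u where u: "\<forall>v\<in>V. 0 \<le> u v" "p = (\<Sum>v\<in>V. u v *\<^sub>R v)"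
    using assms(2) by (auto simp: nonneg_comb_def)
  have "(\<Sum>v\<in>V. u v * v $ i) = 0" using u(2) assms(3) by simp
  then have "\<forall>v\<in>V. u v * v $ i = 0"
    using u assms by (subst (asm) sum_nonneg_eq_0_iff) auto
  then have "p = (\<Sum>v\<in>{v \<in> V. v $ i = 0}. u v *\<^sub>R v)"
    unfolding u(2) using assms(1) by (intro sum.mono_neutral_right) auto
  then show ?thesis using u unfolding nonneg_comb_def by auto
qed

lemma nonneg_comb_zero:
  fixes p :: "real ^ 'n"
  assumes "nonneg_comb V p" "\<And>v. v \<in> V \<Longrightarrow> v $ i = 0"
  shows "p $ i = 0"
  using assms by (auto simp: nonneg_comb_def)

lemma nonneg_comb_linear:
  assumes "nonneg_comb V p" "linear f" "\<And>v. v \<in> V \<Longrightarrow> 0 \<le> (f v :: real)"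
  shows "0 \<le> f p"
  using assms by (auto simp: nonneg_comb_def linear_sum linear_scale intro!: sum_nonneg)

lemma nonneg_comb_singleton: "nonneg_comb {v} p \<Longrightarrow> \<exists>a\<ge>0. p = a *\<^sub>R v"
  by (auto simp: nonneg_comb_def)

lemma nonneg_comb_doubleton:
  assumes "nonneg_comb {v, w} p"
  shows "\<exists>a\<ge>0. \<exists>b\<ge>0. p = a *\<^sub>R v + b *\<^sub>R w"
proof (cases "v = w")
  case True
  with assms nonneg_comb_singleton obtain a where "a \<ge> 0" "p = a *\<^sub>R v" by force
  then show ?thesis by (intro exI[of _ a] conjI exI[of _ 0]) auto
qed (use assms in \<open>auto simp: nonneg_comb_def\<close>)

text \<open>A square root of 3 is an algebraic integer; if rational, it would be an integer, and no
  integer has square 3.\<close>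

lemma rational_square_neq_3:
  assumes "x \<in> \<rat>" shows "x\<^sup>2 \<noteq> (3::real)"
proof
  assume eq: "x\<^sup>2 = 3"
  then have "\<bar>x\<bar> = sqrt 3" by (metis real_sqrt_abs)
  then have "algebraic_int \<bar>x\<bar>" by (simp add: algebraic_int_sqrt int_imp_algebraic_int)
  then have "algebraic_int x" by simp
  then obtain k :: int where "x = of_int k"
    using assms rational_algebraic_int_is_int by (blast elim: Ints_cases)
  with eq have k: "k\<^sup>2 = 3" by (simp flip: of_int_power)
  then have "\<bar>k\<bar> < 2" using abs_le_square_iff[of 2 k] by simp
  then have "k = -1 \<or> k = 0 \<or> k = 1" by linarith
  with k show False by auto
qed


section \<open>The pinched cone and the slopes of generators on its faces\<close>

definition pinched_cone :: "(real ^ 4) set" where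
  "pinched_cone = {y. (\<forall>i. 0 \<le> y $ i) \<and>
     y $ 1 + y $ 3 \<le> 4 * (y $ 2 + y $ 4) \<and> y $ 2 + y $ 4 \<le> 4 * (y $ 1 + y $ 3)}"

lemma pinched_cone_mem [simp]:
  "vec4 a b c d \<in> pinched_cone \<longleftrightarrow> 0 \<le> a \<and> 0 \<le> b \<and> 0 \<le> c \<and> 0 \<le> d \<and>
     a + c \<le> 4 * (b + d) \<and> b + d \<le> 4 * (a + c)"
  by (simp add: pinched_cone_def forall_4)

lemma pinched_cone_eq_0:
  assumes "y \<in> pinched_cone" "y $ 1 = 0 \<and> y $ 3 = 0 \<or> y $ 2 = 0 \<and> y $ 4 = 0"
  shows "y = 0"
proof -
  obtain a b c d where y: "y = vec4 a b c d" by (rule vec4_cases)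
  with assms have "a = 0 \<and> b = 0 \<and> c = 0 \<and> d = 0" by auto
  then show ?thesis by (simp add: y vec4_eq_iff)
qed

lemma pinched_cone_scale:
  assumes "y \<in> pinched_cone" "0 \<le> c"
  shows "c *\<^sub>R y \<in> pinched_cone"
proof -
  have "c * (y $ 1 + y $ 3) \<le> c * (4 * (y $ 2 + y $ 4))" "c * (y $ 2 + y $ 4) \<le> c * (4 * (y $ 1 + y $ 3))"
    using assms by (auto simp: pinched_cone_def intro!: mult_left_mono)
  then show ?thesis using assms by (simp add: pinched_cone_def algebra_simps)
qed

lemma convex_pinched_cone: "convex pinched_cone"
proof (rule convexI)
  fix x y :: "real ^ 4" and u v :: real
  assume "x \<in> pinched_cone" "y \<in> pinched_cone" "0 \<le> u" "0 \<le> v"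
  then have "u *\<^sub>R x \<in> pinched_cone" "v *\<^sub>R y \<in> pinched_cone"
    by (simp_all add: pinched_cone_scale)
  then show "u *\<^sub>R x + v *\<^sub>R y \<in> pinched_cone" by (simp add: pinched_cone_def)
qed

text \<open>The hypotheses are the nonzero coordinates of a vertex of \<open>P\<close> written as
  \<open>s\<close> times one generator plus \<open>t\<close> times the next. Eliminating
  \<open>s\<close> and \<open>t\<close> leaves a relation between the two slopes.\<close>

lemma edge_ratios:
  fixes a b c d s t :: real
  assumes "s * a = 1" "s * b + t * c = 4" "t * d = 1"
  shows "a \<noteq> 0" "d \<noteq> 0" "b / a + c / d = 4"
proof -
  show "a \<noteq> 0" "d \<noteq> 0" using assms by auto
  then have "s = 1 / a" "t = 1 / d" using assms by (simp_all add: field_simps)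
  with assms(2) show "b / a + c / d = 4" by simp
qed

text \<open>The four relations make \<open>r\<^sub>1\<close> a fixed point of the fourth power of the Moebius map
  \<open>r \<mapsto> 1 / (4 - r)\<close>, which has the same fixed points as the map itself.\<close>

lemma ratio_cycle:
  fixes r1 r2 r3 r4 :: real
  assumes "r1 + 1 / r2 = 4" "r2 + 1 / r3 = 4" "r3 + 1 / r4 = 4" "r4 + 1 / r1 = 4"
    and "r1 \<noteq> 0" "r2 \<noteq> 0" "r3 \<noteq> 0" "r4 \<noteq> 0"
  shows "(r1 - 2)\<^sup>2 = 3"
proof -
  define t where "t = 4 - r1"
  have step: "b * (4 - a) = 1" if "a + 1 / b = 4" "b \<noteq> 0" for a b :: real
  proof -
    have "4 - a = 1 / b" using that(1) by simp
    then show ?thesis using that(2) by simp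
  qed
  have 1: "r2 * t = 1" "r3 * (4 - r2) = 1" "r4 * (4 - r3) = 1" "r1 * (4 - r4) = 1"
    using assms step by (simp_all add: t_def)
  \<comment> \<open>With a slope stored as the fraction \<open>n / d\<close>, the Moebius map
    becomes \<open>(n, d) \<mapsto> (d, 4 * d - n)\<close>, and no new denominator has to be shown
    nonzero.\<close>
  have next_step: "s * (4 * d - n) = d" if "r * d = n" "s * (4 - r) = 1" for r s d n :: real
  proof -
    have "s * (4 * d - n) = s * (4 - r) * d" by (simp add: algebra_simps flip: that(1))
    then show ?thesis using that(2) by simp
  qed
  \<comment> \<open>The composite is \<open>r1 * (56 * t - 15) = 15 * t - 4\<close>; substituting
    \<open>t = 4 - r1\<close> gives 56 times the quadratic.\<close>
  from next_step[OF next_step[OF next_step[OF 1(1,2)] 1(3)] 1(4)]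
  have "56 * ((r1 - 2)\<^sup>2 - 3) = 0"
    by (simp add: t_def power2_eq_square algebra_simps)
  then show ?thesis by simp
qed

lemma irrational_generator:
  assumes V: "card V = 4" "V \<subseteq> pinched_cone" "0 \<notin> V"
    and p: "nonneg_comb V (vec4 0 1 4 1)" "nonneg_comb V (vec4 1 0 1 4)"
      "nonneg_comb V (vec4 4 1 0 1)" "nonneg_comb V (vec4 1 4 1 0)"
    and q: "nonneg_comb V (vec4 1 3 1 3)"
  shows "\<exists>v\<in>V. \<not> has_coords_in v \<rat>"
proof (rule ccontr)
  assume "\<not> ?thesis"
  then have rat: "v $ i \<in> \<rat>" if "v \<in> V" for v i using that by (auto simp: has_coords_in_def)
  have fin: "finite V" using V(1) by (metis card.infinite zero_neq_numeral)
  define Z :: "4 \<Rightarrow> (real ^ 4) set" where "Z i = {v \<in> V. v $ i = 0}" for i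
  have nn: "0 \<le> v $ i" if "v \<in> V" for v :: "real ^ 4" and i
    using that V by (auto simp: pinched_cone_def)
  have face: "nonneg_comb (Z i) r" if "nonneg_comb V r" "r $ i = 0" for r i
    unfolding Z_def using nonneg_comb_face[OF fin that] nn by blast
  note pZ = face[OF p(1), of 1, simplified] face[OF p(2), of 2, simplified]
    face[OF p(3), of 3, simplified] face[OF p(4), of 4, simplified]
  \<comment> \<open>If \<open>Z i\<close> were contained in \<open>Z j\<close>, all that
    \<open>Z i\<close> spans would have \<open>j\<close>-th coordinate 0, whereas the chosen vertex
    vanishes only at \<open>i\<close>.\<close>
  have nsub: "\<not> Z i \<subseteq> Z j" if "nonneg_comb (Z i) r" "r $ j \<noteq> 0" for i j r
    using nonneg_comb_zero[OF that(1), of j] that(2) by (auto simp: Z_def)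
  have dis: "Z 1 \<inter> Z 3 = {}" "Z 2 \<inter> Z 4 = {}"
    using pinched_cone_eq_0 V by (auto simp: Z_def)
  have sub: "Z 1 \<union> Z 2 \<union> Z 3 \<union> Z 4 \<subseteq> V" by (auto simp: Z_def)
  show False
  proof (rule antichain_four_cases[OF V(1) sub dis nsub[OF pZ(1)] nsub[OF pZ(1)] nsub[OF pZ(1)]
        nsub[OF pZ(2)] nsub[OF pZ(2)] nsub[OF pZ(2)] nsub[OF pZ(3)] nsub[OF pZ(3)] nsub[OF pZ(3)]
        nsub[OF pZ(4)] nsub[OF pZ(4)] nsub[OF pZ(4)]])
    fix a b c d
    assume Z: "Z 1 = {a}" "Z 2 = {b}" "Z 3 = {c}" "Z 4 = {d}" and Veq: "V = {a, b, c, d}"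
    \<comment> \<open>A separating functional: it takes the values 6, 0, 6, 0 on the first four
      points and -2 on \<open>(1, 3, 1, 3)\<close>.\<close>
    define f :: "real ^ 4 \<Rightarrow> real" where "f y = 2 * (y $ 1 + y $ 3) - (y $ 2 + y $ 4)" for y
    have lin: "linear f" by (rule linearI) (simp_all add: f_def algebra_simps)
    have pos: "0 \<le> f v" if "nonneg_comb {v} r" "0 \<le> f r" "r \<noteq> 0" for v r
    proof -
      obtain s where s: "s \<ge> 0" "r = s *\<^sub>R v" using nonneg_comb_singleton[OF \<open>nonneg_comb {v} r\<close>] by auto
      then have "s > 0" using \<open>r \<noteq> 0\<close> by (cases "s = 0") auto
      then show ?thesis using s \<open>0 \<le> f r\<close> by (simp add: linear_scale[OF lin] zero_le_mult_iff)
    qed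
    have "0 \<le> f a" "0 \<le> f b" "0 \<le> f c" "0 \<le> f d"
      by (rule pZ[unfolded Z, THEN pos]; simp add: f_def vec4_eq_iff)+
    then have "0 \<le> f v" if "v \<in> V" for v
      using that by (auto simp: Veq)
    from nonneg_comb_linear[OF q lin this] show False by (simp add: f_def)
  next
    fix w x y z
    assume Z: "Z 1 = {w, x}" "Z 2 = {x, y}" "Z 3 = {y, z}" "Z 4 = {z, w}"
    have inV: "w \<in> V" "x \<in> V" "y \<in> V" "z \<in> V" and
      0: "w $ 1 = 0" "w $ 4 = 0" "x $ 1 = 0" "x $ 2 = 0" "y $ 2 = 0" "y $ 3 = 0" "z $ 3 = 0" "z $ 4 = 0"
      using Z by (auto simp: Z_def)
    obtain s t where "vec4 0 1 4 1 = s *\<^sub>R w + t *\<^sub>R x"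
      using pZ(1) Z nonneg_comb_doubleton by metis
    then have 1: "s * w $ 2 = 1" "s * w $ 3 + t * x $ 3 = 4" "t * x $ 4 = 1"
      using 0 by (simp_all add: vec4_eq_iff)
    obtain s t where "vec4 1 0 1 4 = s *\<^sub>R x + t *\<^sub>R y"
      using pZ(2) Z nonneg_comb_doubleton by metis
    then have 2: "s * x $ 3 = 1" "s * x $ 4 + t * y $ 4 = 4" "t * y $ 1 = 1"
      using 0 by (simp_all add: vec4_eq_iff)
    obtain s t where "vec4 4 1 0 1 = s *\<^sub>R y + t *\<^sub>R z"
      using pZ(3) Z nonneg_comb_doubleton by metis
    then have 3: "s * y $ 4 = 1" "s * y $ 1 + t * z $ 1 = 4" "t * z $ 2 = 1"
      using 0 by (simp_all add: vec4_eq_iff)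
    obtain s t where "vec4 1 4 1 0 = s *\<^sub>R z + t *\<^sub>R w"
      using pZ(4) Z nonneg_comb_doubleton by metis
    then have 4: "s * z $ 1 = 1" "s * z $ 2 + t * w $ 2 = 4" "t * w $ 3 = 1"
      using 0 by (simp_all add: vec4_eq_iff)
    note e = edge_ratios[OF 1] edge_ratios[OF 2] edge_ratios[OF 3] edge_ratios[OF 4]
    \<comment> \<open>The slope of a generator is the quotient of its two possibly nonzero
      coordinates, the cyclically later one over the earlier; each facet links two consecutive
      slopes.\<close>
    have "(w $ 3 / w $ 2 - 2)\<^sup>2 = 3"
      by (rule ratio_cycle[of _ "x $ 4 / x $ 3" "y $ 1 / y $ 4" "z $ 2 / z $ 1"]) (use e in auto)
    moreover have "w $ 3 / w $ 2 - 2 \<in> \<rat>" using rat inV by auto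
    ultimately show False using rational_square_neq_3 by blast
  qed (simp_all)
qed

section \<open>The two polytopes and an irrational simplex between them\<close>

lemma convex_comb4:
  assumes "convex S" "0 \<in> S" "v1 \<in> S" "v2 \<in> S" "v3 \<in> S" "v4 \<in> S"
    and "0 \<le> a1" "0 \<le> a2" "0 \<le> a3" "0 \<le> a4" "a1 + a2 + a3 + a4 \<le> (1::real)"
  shows "a1 *\<^sub>R v1 + a2 *\<^sub>R v2 + a3 *\<^sub>R v3 + a4 *\<^sub>R v4 \<in> S"
proof -
  \<comment> \<open>The weight missing from 1 is given to the point 0.\<close>
  let ?a = "\<lambda>i. [1 - (a1 + a2 + a3 + a4), a1, a2, a3, a4] ! i"
  let ?v = "\<lambda>i. [0, v1, v2, v3, v4] ! i"
  have "(\<Sum>i<5. ?a i *\<^sub>R ?v i) \<in> S"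
  proof (rule convex_sum)
    fix i :: nat assume "i \<in> {..<5}"
    then have "i \<in> {0, 1, 2, 3, 4}" by auto
    then show "0 \<le> ?a i" "?v i \<in> S" using assms by auto
  qed (use assms in \<open>simp_all add: eval_nat_numeral\<close>)
  then show ?thesis by (simp add: eval_nat_numeral algebra_simps)
qed

lemma subfield_Rats: "subfield \<rat> (ring_of_type_algebra :: 'a :: field_char_0 ring)"
proof -
  interpret R: field "ring_of_type_algebra :: 'a ring" by (rule field_from_type_algebra)
  let ?R = "ring_of_type_algebra :: 'a ring"
  have simps: "carrier ?R = UNIV" "\<one>\<^bsub>?R\<^esub> = 1" "\<zero>\<^bsub>?R\<^esub> = 0"
    "x \<otimes>\<^bsub>?R\<^esub> y = x * y" "x \<oplus>\<^bsub>?R\<^esub> y = x + y" for x y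
    by (simp_all add: ring_of_type_algebra_def)
  have minus: "\<ominus>\<^bsub>?R\<^esub> x = - x" for x
    using R.minus_equality[of "- x" x] by (simp add: simps)
  have inv: "inv\<^bsub>?R\<^esub> x = inverse x" if "x \<noteq> 0" for x
    using R.inv_unique'[of x "inverse x"] that by (simp add: simps)
  show ?thesis
    by (intro R.subfieldI' R.subringI) (auto simp: simps minus inv)
qed

text \<open>The entry 4 is the sum of the mutually inverse slopes \<open>2 + sqrt 3\<close> and
  \<open>2 - sqrt 3\<close>. For the last point, the ratio of \<open>y $ 2 + y $ 4\<close> to
  \<open>y $ 1 + y $ 3\<close> is 3, between the bound 2 valid for the other points and the bound
  \<open>2 + sqrt 3\<close> valid on the simplex below.\<close>

definition inner_points :: "(real ^ 4) set" where
  "inner_points = {0, vec4 0 1 4 1, vec4 1 0 1 4, vec4 4 1 0 1, vec4 1 4 1 0, vec4 1 3 1 3}"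

text \<open>On each of four two-dimensional faces of the orthant, two rational points whose slopes 3
  and 4 enclose \<open>2 + sqrt 3\<close>. The common scale 2 leaves room for
  \<open>inner_points\<close>.\<close>

definition outer_points :: "(real ^ 4) set" where
  "outer_points = {0, vec4 2 6 0 0, vec4 2 8 0 0, vec4 0 2 6 0, vec4 0 2 8 0,
     vec4 0 0 2 6, vec4 0 0 2 8, vec4 6 0 0 2, vec4 8 0 0 2}"

definition simplex_points :: "real \<Rightarrow> (real ^ 4) set" where
  "simplex_points x = {0, vec4 2 (2 * x) 0 0, vec4 0 2 (2 * x) 0, vec4 0 0 2 (2 * x), vec4 (2 * x) 0 0 2}"

lemma inner_points_simps [simp]:
  "0 \<in> inner_points" "vec4 0 1 4 1 \<in> inner_points" "vec4 1 0 1 4 \<in> inner_points"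
  "vec4 4 1 0 1 \<in> inner_points" "vec4 1 4 1 0 \<in> inner_points" "vec4 1 3 1 3 \<in> inner_points"
  by (simp_all add: inner_points_def)

lemma aff_dim_inner_points: "aff_dim inner_points = 4"
proof -
  have "y \<in> span inner_points" for y :: "real ^ 4"
  proof -
    \<comment> \<open>The matrix of these four points is circulant, so one row of its inverse with
      rotated arguments gives all coefficients.\<close>
    define k where "k a b c d = (a - 2 * b + 7 * c - 2 * d) / 24" for a b c d :: real
    obtain a b c d where "y = vec4 a b c d" by (rule vec4_cases)
    then have "y = k a b c d *\<^sub>R vec4 0 1 4 1 + k b c d a *\<^sub>R vec4 1 0 1 4
        + k c d a b *\<^sub>R vec4 4 1 0 1 + k d a b c *\<^sub>R vec4 1 4 1 0"
      by (simp add: vec4_eq_iff k_def) argo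
    also have "\<dots> \<in> span inner_points"
      by (intro span_add span_scale span_base) simp_all
    finally show ?thesis .
  qed
  then have "affine hull inner_points = UNIV"
    by (subst affine_hull_span_0) (auto intro: hull_inc)
  then show ?thesis using aff_dim_eq_full[of inner_points] by simp
qed

text \<open>The upper bound 9/5 is what makes the weight \<open>(9 - 5 * sqrt 3) / 12\<close> used
  below positive.\<close>

lemma sqrt_3_bounds: "17 / 10 < sqrt 3" "sqrt 3 < 18 / 10"
  by (rule real_less_rsqrt, simp add: power2_eq_square)
    (rule real_less_lsqrt, simp_all add: power2_eq_square)

lemma simplex_subset_outer: "convex hull simplex_points (2 + sqrt 3) \<subseteq> convex hull outer_points"
  (is "_ \<subseteq> ?Q")
proof (rule hull_minimal)
  \<comment> \<open>The weights solve \<open>6 * u + 8 * v = 2 * (2 + sqrt 3)\<close> with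
    \<open>u + v = 1\<close>.\<close>
  have seg: "y \<in> ?Q"
    if "y = (2 - sqrt 3) *\<^sub>R a + (sqrt 3 - 1) *\<^sub>R b" "a \<in> outer_points" "b \<in> outer_points" for a b y
    unfolding that(1) using that(2,3) sqrt_3_bounds by (intro convexD) (auto intro: hull_inc)
  have "vec4 2 (2 * (2 + sqrt 3)) 0 0 \<in> ?Q"
    by (rule seg[of _ "vec4 2 6 0 0" "vec4 2 8 0 0"])
      (simp add: vec4_eq_iff algebra_simps, simp_all add: outer_points_def)
  moreover have "vec4 0 2 (2 * (2 + sqrt 3)) 0 \<in> ?Q"
    by (rule seg[of _ "vec4 0 2 6 0" "vec4 0 2 8 0"])
      (simp add: vec4_eq_iff algebra_simps, simp_all add: outer_points_def)
  moreover have "vec4 0 0 2 (2 * (2 + sqrt 3)) \<in> ?Q"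
    by (rule seg[of _ "vec4 0 0 2 6" "vec4 0 0 2 8"])
      (simp add: vec4_eq_iff algebra_simps, simp_all add: outer_points_def)
  moreover have "vec4 (2 * (2 + sqrt 3)) 0 0 2 \<in> ?Q"
    by (rule seg[of _ "vec4 6 0 0 2" "vec4 8 0 0 2"])
      (simp add: vec4_eq_iff algebra_simps, simp_all add: outer_points_def)
  moreover have "0 \<in> ?Q" by (rule hull_inc) (simp add: outer_points_def)
  ultimately show "simplex_points (2 + sqrt 3) \<subseteq> ?Q" unfolding simplex_points_def by blast
qed simp

lemma inner_subset_simplex: "convex hull inner_points \<subseteq> convex hull simplex_points (2 + sqrt 3)"
  (is "_ \<subseteq> ?D")
proof (rule hull_minimal)
  define x where "x = 2 + sqrt 3"
  have comb: "y \<in> ?D"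
    if "y = a1 *\<^sub>R vec4 2 (2 * x) 0 0 + a2 *\<^sub>R vec4 0 2 (2 * x) 0
        + a3 *\<^sub>R vec4 0 0 2 (2 * x) + a4 *\<^sub>R vec4 (2 * x) 0 0 2"
      "0 \<le> a1" "0 \<le> a2" "0 \<le> a3" "0 \<le> a4" "a1 + a2 + a3 + a4 \<le> 1" for a1 a2 a3 a4 y
    unfolding that(1) using that(2-) by (intro convex_comb4 hull_inc) (auto simp: simplex_points_def x_def)
  \<comment> \<open>Here \<open>?b = 1 / (2 * x)\<close>, so that weights 1/2 and \<open>?b\<close>
    produce the middle entry \<open>x + 1 / x = 4\<close>. The weights \<open>?c\<close> and
    \<open>?d\<close> solve \<open>2 * c + 2 * x * d = 1\<close> and
    \<open>2 * x * c + 2 * d = 3\<close>.\<close>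
  let ?b = "(2 - sqrt 3) / 2" and ?c = "(3 + sqrt 3) / 12" and ?d = "(9 - 5 * sqrt 3) / 12"
  note simps = vec4_eq_iff x_def field_simps
  have "vec4 1 4 1 0 \<in> ?D"
    by (rule comb[of _ "1/2" ?b 0 0]) (use sqrt_3_bounds in \<open>simp_all add: simps\<close>)
  moreover have "vec4 0 1 4 1 \<in> ?D"
    by (rule comb[of _ 0 "1/2" ?b 0]) (use sqrt_3_bounds in \<open>simp_all add: simps\<close>)
  moreover have "vec4 1 0 1 4 \<in> ?D"
    by (rule comb[of _ 0 0 "1/2" ?b]) (use sqrt_3_bounds in \<open>simp_all add: simps\<close>)
  moreover have "vec4 4 1 0 1 \<in> ?D"
    by (rule comb[of _ ?b 0 0 "1/2"]) (use sqrt_3_bounds in \<open>simp_all add: simps\<close>)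
  moreover have "vec4 1 3 1 3 \<in> ?D"
    by (rule comb[of _ ?c ?d ?c ?d]) (use sqrt_3_bounds in \<open>simp_all add: simps\<close>)
  moreover have "0 \<in> ?D" by (rule hull_inc) (simp add: simplex_points_def)
  ultimately show "inner_points \<subseteq> ?D" unfolding inner_points_def by blast
qed simp

text \<open>Affine independence comes from dimension: the hull of these at most five points contains
  a four-dimensional polytope.\<close>

lemma simplex_hull_simplex_points: "4 simplex (convex hull simplex_points (2 + sqrt 3))"
proof -
  let ?D = "simplex_points (2 + sqrt 3)"
  have fin: "finite ?D" by (simp add: simplex_points_def)
  have "card ?D \<le> 5"
    using card_length[of "[0, vec4 2 (2 * (2 + sqrt 3)) 0 0, vec4 0 2 (2 * (2 + sqrt 3)) 0,
      vec4 0 0 2 (2 * (2 + sqrt 3)), vec4 (2 * (2 + sqrt 3)) 0 0 2]"]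
    by (simp add: simplex_points_def)
  moreover have "4 \<le> aff_dim ?D"
    using aff_dim_subset[OF inner_subset_simplex] aff_dim_inner_points
    by (simp add: aff_dim_convex_hull)
  moreover have "aff_dim ?D \<le> int (card ?D) - 1"
    using fin by (rule aff_dim_le_card)
  ultimately have "aff_dim ?D = int (card ?D) - 1" "int (card ?D) = 4 + 1"
    by linarith+
  with fin have "\<not> affine_dependent ?D \<and> int (card ?D) = 4 + 1"
    by (simp add: affine_independent_iff_card)
  then show ?thesis by (rule simplex_convex_hull)
qed

section \<open>Vertices of an arbitrary simplex between the polytopes\<close>

lemma outer_subset_pinched_cone: "convex hull outer_points \<subseteq> pinched_cone"
proof (rule hull_minimal)
  have "0 \<in> pinched_cone" by (simp add: pinched_cone_def)
  \<comment> \<open>The factor 4 in \<open>pinched_cone\<close> is attained here: at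
    \<open>vec4 2 8 0 0\<close> in one inequality, at \<open>vec4 0 2 8 0\<close> in the
    other.\<close>
  then show "outer_points \<subseteq> pinched_cone" by (simp add: outer_points_def)
qed (rule convex_pinched_cone)

lemma zero_mem_vertices:
  fixes C :: "(real ^ 'n) set"
  assumes "finite C" "0 \<in> convex hull C" and nn: "\<And>v i. v \<in> C \<Longrightarrow> 0 \<le> v $ i"
  shows "0 \<in> C"
proof -
  obtain u where u: "\<forall>v\<in>C. 0 \<le> u v" "sum u C = 1" "(\<Sum>v\<in>C. u v *\<^sub>R v) = 0"
    using assms by (auto simp: convex_hull_finite)
  obtain v where v: "v \<in> C" "u v \<noteq> 0"
    using u(2) sum.neutral[of C u] by fastforce
  \<comment> \<open>The origin is extreme in the orthant, so a point carrying weight in a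
    representation of 0 must itself be 0.\<close>
  have "v $ i = 0" for i
  proof -
    have "(\<Sum>v\<in>C. u v * v $ i) = 0"
      using arg_cong[OF u(3), of "\<lambda>y. y $ i"] by simp
    then have "\<forall>v\<in>C. u v * v $ i = 0"
      using assms(1) u(1) nn by (subst (asm) sum_nonneg_eq_0_iff) auto
    then show ?thesis using v by auto
  qed
  then have "v = 0" by (simp add: vec_eq_iff)
  with v show ?thesis by simp
qed

lemma irrational_vertex:
  assumes "4 simplex \<Delta>" "convex hull inner_points \<subseteq> \<Delta>" "\<Delta> \<subseteq> convex hull outer_points"
  shows "\<exists>v. v extreme_point_of \<Delta> \<and> \<not> has_coords_in v \<rat>"
proof -
  obtain C where C: "\<not> affine_dependent C" "card C = 5" "\<Delta> = convex hull C"
    using assms(1) by (auto simp: simplex_def)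
  have fin: "finite C" using C(1) by (rule aff_independent_finite)
  have CK: "C \<subseteq> pinched_cone"
    using assms(3) outer_subset_pinched_cone hull_subset[of C convex] C(3) by blast
  have mem: "p \<in> convex hull C" if "p \<in> inner_points" for p
    using hull_inc[OF that] assms(2) C(3) by blast
  have "0 \<in> C"
    by (rule zero_mem_vertices[OF fin]) (use mem CK in \<open>auto simp: pinched_cone_def\<close>)
  then have "card (C - {0}) = 4" using C(2) fin by simp
  then have "\<exists>v\<in>C - {0}. \<not> has_coords_in v \<rat>"
  proof (rule irrational_generator)
    show "C - {0} \<subseteq> pinched_cone" using CK by blast
  qed (simp_all add: convex_hull_imp_nonneg_comb[OF fin mem])
  \<comment> \<open>By affine independence every point of \<open>C\<close> is extreme, so the
    irrational generator is a vertex.\<close>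
  then show ?thesis
    using extreme_point_of_convex_hull_affine_independent[OF C(1)] C(3) by auto
qed

theorem theorem1:
  shows "\<exists>(F :: real set) (P :: (real ^ 4) set) (Q :: (real ^ 4) set).
    subfield F (ring_of_type_algebra :: real ring) \<and>
    polytope P \<and> polytope Q \<and>
    (\<forall>v. v extreme_point_of P \<or> v extreme_point_of Q \<longrightarrow> has_coords_in v F) \<and>
    aff_dim P = 4 \<and> P \<subseteq> Q \<and>
    (\<exists>\<Delta>. 4 simplex \<Delta> \<and> P \<subseteq> \<Delta> \<and> \<Delta> \<subseteq> Q) \<and>
    (\<forall>\<Delta>. 4 simplex \<Delta> \<and> P \<subseteq> \<Delta> \<and> \<Delta> \<subseteq> Q \<longrightarrow>
      (\<exists>v. v extreme_point_of \<Delta> \<and> \<not> has_coords_in v F))"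
proof (rule exI[of _ "\<rat>"], rule exI[of _ "convex hull inner_points"],
    rule exI[of _ "convex hull outer_points"], intro conjI allI impI)
  show "subfield \<rat> (ring_of_type_algebra :: real ring)" by (rule subfield_Rats)
  show "polytope (convex hull inner_points)" "polytope (convex hull outer_points)"
    by (simp_all add: polytope_convex_hull inner_points_def outer_points_def)
  show "has_coords_in v \<rat>"
    if "v extreme_point_of convex hull inner_points \<or> v extreme_point_of convex hull outer_points" for v
  proof -
    \<comment> \<open>Extreme points of a hull lie in the generating set, so it suffices to inspect
      the listed rational points.\<close>
    from that have "v \<in> inner_points \<union> outer_points" by (auto dest: extreme_point_of_convex_hull)
    then show ?thesis by (auto simp: inner_points_def outer_points_def has_coords_in_def forall_4)
  qed
  show "aff_dim (convex hull inner_points) = 4"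
    by (simp add: aff_dim_convex_hull aff_dim_inner_points)
  show "convex hull inner_points \<subseteq> convex hull outer_points"
    using inner_subset_simplex simplex_subset_outer by (rule subset_trans)
  show "\<exists>\<Delta>. 4 simplex \<Delta> \<and> convex hull inner_points \<subseteq> \<Delta> \<and> \<Delta> \<subseteq> convex hull outer_points"
    using simplex_hull_simplex_points inner_subset_simplex simplex_subset_outer by blast
qed (erule conjE, erule conjE, rule irrational_vertex)

end
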